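(* For every integer $M\ge1$ and every $\gamma$ with $0<\gamma<3-\frac{3}{M+1}$, there exists a sporadic task set ${\bf T}$ (with arbitrary deadlines) such that, for each of the following three per-processor tests, the deadline-monotonic partitioning algorithm with $M$ unit-speed processors returns failure on ${\bf T}$ for some fitting strategy (i.e., for some sequence of choices among the processors that pass the test), while $\Lambda({\bf T})\le\frac{1}{3-\frac{3}{M+1}-\gamma}$: (i) $C_k+\sum_{\tau_i\in{\bf T}_m}(1+\frac{D_k}{T_i})C_i\le D_k$ and $U_k+\sum_{\tau_i\in{\bf T}_m}U_i\le1$; (ii) $C_k+D_k\sum_{\tau_i\in{\bf T}_m}U_i+\sum_{\tau_i\in{\bf T}_m}C_i-\sum_{\tau_i\in{\bf T}_m}U_iC_i\le D_k$ and $U_k+\sum_{\tau_i\in{\bf T}_m}U_i\le1$; (iii) the exact test: the worst-case response time of $\tau_k$ under preemptive fixed-priority scheduling of ${\bf T}_m\cup\{\tau_k\}$ on one unit-speed processor, with all tasks of ${\bf T}_m$ of higher priority, is at most $D_k$. In particular, under an arbitrary fitting strategy the speedup factor of the algorithm with any of these tests, as measured against $\Lambda$, is at least $3-\frac{3}{M+1}-\gamma$.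
   Context: A sporadic task $\tau_i=(C_i,T_i,D_i)$ has worst-case execution time $C_i>0$, minimum inter-arrival time $T_i>0$ ($T_i=\infty$ allowed, meaning at most one job, with $U_i=0$), and relative deadline $D_i>0$; consecutive job releases are at least $T_i$ apart, each job must complete within $D_i$ of its release. $U_i=C_i/T_i$, $\Delta_i=\max\{U_i,C_i/D_i\}$, $\mathrm{dbf}(\tau_i,t)=\max\{0,\lfloor (t-D_i)/T_i\rfloor+1\}\cdot C_i$. For $M$ processors, $$\Lambda({\bf T})=\max\Big\{\sup_{t>0}\frac{\sum_{\tau_i\in{\bf T}}\mathrm{dbf}(\tau_i,t)}{Mt},\ \frac{\sum_{\tau_i\in{\bf T}}U_i}{M},\ \max_{\tau_i\in{\bf T}}\Delta_i\Big\};$$ no multiprocessor scheduling algorithm can schedule ${\bf T}$ on $M$ processors of speed $s<\Lambda({\bf T})$. Deadline-monotonic partitioning algorithm: tasks are indexed by non-decreasing relative deadline; set ${\bf T}_1=\{\tau_1\}$, ${\bf T}_m=\emptyset$ for $m\ge2$; for $k=2,\dots,N$, if some processor $m$ has ${\bf T}_m\cup\{\tau_k\}$ passing the test, choose one such $m$ by the fitting strategy and add $\tau_k$ to ${\bf T}_m$, else return failure. *)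

theory Defs
  imports "HOL-Analysis.Analysis"
begin

datatype task = Task (wcet: real) (period: ereal) (deadline: real)

definition valid_task :: "task \<Rightarrow> bool" where
  "valid_task \<tau> \<longleftrightarrow> 0 < wcet \<tau> \<and> 0 < period \<tau> \<and> 0 < deadline \<tau>"

text \<open>
  A task set is a family of tasks indexed by non-decreasing relative deadline, hence a list: several
  of its tasks may have the same parameters.
\<close>

definition task_set :: "task list \<Rightarrow> bool" where
  "task_set ts \<longleftrightarrow> ts \<noteq> [] \<and> (\<forall>\<tau>\<in>set ts. valid_task \<tau>) \<and> sorted (map deadline ts)"

text \<open>The quotient of a real by the period; it is \<open>0\<close> if the period is infinite.\<close>

definition over_period :: "real \<Rightarrow> task \<Rightarrow> real" where
  "over_period x \<tau> = real_of_ereal (ereal x / period \<tau>)"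

definition util :: "task \<Rightarrow> real" where
  "util \<tau> = over_period (wcet \<tau>) \<tau>"

definition density :: "task \<Rightarrow> real" where
  "density \<tau> = max (util \<tau>) (wcet \<tau> / deadline \<tau>)"

text \<open>
  The infinite period needs a case of its own: as the limit of \<open>\<lfloor>(t - D) / T\<rfloor>\<close> for
  \<open>T\<close> tending to infinity is \<open>-1\<close> for \<open>t < D\<close>, the single job counts from \<open>t = D\<close> on only.
\<close>

definition dbf :: "task \<Rightarrow> real \<Rightarrow> real" where
  "dbf \<tau> t =
     (if period \<tau> = \<infinity> then (if t < deadline \<tau> then 0 else wcet \<tau>)
      else max 0 (of_int \<lfloor>(t - deadline \<tau>) / real_of_ereal (period \<tau>)\<rfloor> + 1) * wcet \<tau>)"

definition Lam :: "nat \<Rightarrow> task list \<Rightarrow> ereal" where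
  "Lam M ts =
     Max {SUP t\<in>{0<..}. ereal ((\<Sum>\<tau>\<leftarrow>ts. dbf \<tau> t) / (real M * t)),
          ereal ((\<Sum>\<tau>\<leftarrow>ts. util \<tau>) / real M),
          ereal (Max (density ` set ts))}"

text \<open>
  Preemptive fixed-priority scheduling on one unit-speed processor: the tasks of a list are
  given in order of decreasing priority. A job is identified by the
  position of its task and its release time; \<open>R i\<close> is the set of release times of the task at
  position \<open>i\<close>, and \<open>e J\<close> is the actual execution time of the job \<open>J\<close>.
\<close>

type_synonym job = "nat \<times> real"

definition legal_releases :: "task list \<Rightarrow> (nat \<Rightarrow> real set) \<Rightarrow> bool" where
  "legal_releases ts R \<longleftrightarrow>
     (\<forall>i<length ts. R i \<subseteq> {0..} \<and>
        (\<forall>r\<in>R i. \<forall>r'\<in>R i. r < r' \<longrightarrow> period (ts ! i) \<le> ereal (r' - r)))"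

definition legal_execution :: "task list \<Rightarrow> (nat \<Rightarrow> real set) \<Rightarrow> (job \<Rightarrow> real) \<Rightarrow> bool" where
  "legal_execution ts R e \<longleftrightarrow>
     (\<forall>i<length ts. \<forall>r\<in>R i. 0 < e (i, r) \<and> e (i, r) \<le> wcet (ts ! i))"

type_synonym schedule = "real \<Rightarrow> job option"

definition service :: "schedule \<Rightarrow> job \<Rightarrow> real \<Rightarrow> real" where
  "service \<sigma> J t = measure lborel {s \<in> {0..<t}. \<sigma> s = Some J}"

definition pending ::
    "task list \<Rightarrow> (nat \<Rightarrow> real set) \<Rightarrow> (job \<Rightarrow> real) \<Rightarrow> schedule \<Rightarrow> real \<Rightarrow> job set" where
  "pending ts R e \<sigma> t =
     {(i, r). i < length ts \<and> r \<in> R i \<and> r \<le> t \<and> service \<sigma> (i, r) t < e (i, r)}"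

text \<open>Jobs of the same task are served in the order of their release.\<close>

definition precedes :: "job \<Rightarrow> job \<Rightarrow> bool" where
  "precedes J J' \<longleftrightarrow> fst J < fst J' \<or> (fst J = fst J' \<and> snd J < snd J')"

definition fp_schedule ::
    "task list \<Rightarrow> (nat \<Rightarrow> real set) \<Rightarrow> (job \<Rightarrow> real) \<Rightarrow> schedule \<Rightarrow> bool" where
  "fp_schedule ts R e \<sigma> \<longleftrightarrow>
     (\<forall>J. {s. \<sigma> s = Some J} \<in> sets lborel) \<and>
     (\<forall>t\<ge>0. case \<sigma> t of
        None \<Rightarrow> pending ts R e \<sigma> t = {}
      | Some J \<Rightarrow> J \<in> pending ts R e \<sigma> t \<and>
          (\<forall>J'\<in>pending ts R e \<sigma> t. J' \<noteq> J \<longrightarrow> precedes J J'))"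

text \<open>The response time is infinite if the job never completes.\<close>

definition response_time :: "(job \<Rightarrow> real) \<Rightarrow> schedule \<Rightarrow> job \<Rightarrow> ereal" where
  "response_time e \<sigma> J = Inf {ereal t | t. service \<sigma> J t \<ge> e J} - ereal (snd J)"

definition wcrt :: "task list \<Rightarrow> nat \<Rightarrow> ereal" where
  "wcrt ts k =
     Sup {response_time e \<sigma> (k, r) | R e \<sigma> r.
            legal_releases ts R \<and> legal_execution ts R e \<and> fp_schedule ts R e \<sigma> \<and> r \<in> R k}"

text \<open>
  A test takes the tasks already on the processor, in order of decreasing priority, and the task to
  be added.
\<close>

type_synonym fp_test = "task list \<Rightarrow> task \<Rightarrow> bool"

definition linear_test :: fp_test where
  "linear_test Tm \<tau> \<longleftrightarrow>
     wcet \<tau> + (\<Sum>\<tau>'\<leftarrow>Tm. (1 + over_period (deadline \<tau>) \<tau>') * wcet \<tau>') \<le> deadline \<tau> \<and>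
     util \<tau> + (\<Sum>\<tau>'\<leftarrow>Tm. util \<tau>') \<le> 1"

definition quadratic_test :: fp_test where
  "quadratic_test Tm \<tau> \<longleftrightarrow>
     wcet \<tau> + deadline \<tau> * (\<Sum>\<tau>'\<leftarrow>Tm. util \<tau>') + (\<Sum>\<tau>'\<leftarrow>Tm. wcet \<tau>')
       - (\<Sum>\<tau>'\<leftarrow>Tm. util \<tau>' * wcet \<tau>') \<le> deadline \<tau> \<and>
     util \<tau> + (\<Sum>\<tau>'\<leftarrow>Tm. util \<tau>') \<le> 1"

definition exact_test :: fp_test where
  "exact_test Tm \<tau> \<longleftrightarrow> wcrt (Tm @ [\<tau>]) (length Tm) \<le> ereal (deadline \<tau>)"

text \<open>
  The processors are \<open>0, \<dots>, M - 1\<close>, and \<open>P m\<close> lists the tasks on processor \<open>m\<close>. The choice of a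
  processor by the fitting strategy is nondeterministic: \<open>may_fail test M P ts\<close> holds iff some
  sequence of choices makes the algorithm return failure when the tasks \<open>ts\<close> remain to be assigned.
\<close>

inductive may_fail :: "fp_test \<Rightarrow> nat \<Rightarrow> (nat \<Rightarrow> task list) \<Rightarrow> task list \<Rightarrow> bool"
  for test :: fp_test and M :: nat where
  fail: "(\<forall>m<M. \<not> test (P m) \<tau>) \<Longrightarrow> may_fail test M P (\<tau> # ts)"
| assign: "m < M \<Longrightarrow> test (P m) \<tau> \<Longrightarrow> may_fail test M (P(m := P m @ [\<tau>])) ts \<Longrightarrow>
    may_fail test M P (\<tau> # ts)"

definition dm_may_fail :: "fp_test \<Rightarrow> nat \<Rightarrow> task list \<Rightarrow> bool" where
  "dm_may_fail test M ts \<longleftrightarrow> may_fail test M ((\<lambda>_. [])(0 := [hd ts])) (tl ts)"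

text \<open>
  The speedup factor with respect to the lower bound \<open>Lam\<close> on the necessary speed, under an
  arbitrary fitting strategy. It is infinite if no speedup suffices.
\<close>

definition speedup_factor :: "fp_test \<Rightarrow> nat \<Rightarrow> ereal" where
  "speedup_factor test M =
     Inf {ereal \<rho> | \<rho>. 0 < \<rho> \<and>
       (\<forall>ts. task_set ts \<and> Lam M ts \<le> ereal (1 / \<rho>) \<longrightarrow> \<not> dm_may_fail test M ts)}"

end

theory Submission
  imports Defs
begin

text \<open>
  All tasks get the same relative deadline \<open>n\<close>, and every processor first receives a task with
  utilization \<open>u\<close> and period 1, then a task with a single job. Since \<open>n\<close> is much larger than the
  period, the first task demands only \<open>u\<close> by time \<open>n\<close>, although it interferes with lower-priority
  jobs from time 0 on. So the demand at time \<open>n\<close>, the utilization and the density of the last task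
  can all be about a third of the capacity, while on every processor they add up to more than \<open>n\<close>
  for the response time of the last task. The two execution times are multiples \<open>a\<close> and \<open>b\<close> of
  \<open>1 - u\<close> with \<open>a + b = n + 1\<close>: from a synchronous release, the single jobs fill exactly the
  first \<open>n + 1\<close> gaps left by the periodic task.
\<close>

section \<open>Runs of the partitioning algorithm in layers\<close>

text \<open>The processors are filled in the order of their numbers, so a layer of \<open>M\<close>
  equal tasks leaves all of them with the same contents. As \<open>may_fail\<close> describes the
  rest of a run, the induction goes from the complete layer \<open>j = M\<close> downwards.\<close>

lemma may_fail_fill:
  assumes "test x \<tau>" and "\<And>m. m < M \<Longrightarrow> P m = x" and "j \<le> M"
    and "may_fail test M (\<lambda>m. if m < M then x @ [\<tau>] else P m) ts"
  shows "may_fail test M (\<lambda>m. if m < j then x @ [\<tau>] else P m) (replicate (M - j) \<tau> @ ts)"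
  using assms(3)
proof (induction j rule: inc_induct)
  case base
  then show ?case using assms(4) by simp
next
  case (step j)
  have "(\<lambda>m. if m < j then x @ [\<tau>] else P m)(j := P j @ [\<tau>])
      = (\<lambda>m. if m < Suc j then x @ [\<tau>] else P m)"
    using assms(2)[OF step.hyps(2)] by (auto simp: fun_eq_iff less_Suc_eq)
  moreover have "replicate (M - j) \<tau> @ ts = \<tau> # (replicate (M - Suc j) \<tau> @ ts)"
    using step.hyps(2) by (metis Suc_diff_Suc append_Cons replicate_Suc)
  ultimately show ?case
    using may_fail.assign[where P = "\<lambda>m. if m < j then x @ [\<tau>] else P m" and m = j]
      step assms(1,2) by simp
qed

text \<open>The algorithm itself puts the first task on processor 0, so the first layer enters
  \<open>may_fail_fill\<close> at \<open>j = 1\<close> and the second at \<open>j = 0\<close>. After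
  both layers all processors look alike, and one rejection of \<open>\<tau>\<^sub>3\<close> is a
  rejection everywhere.\<close>

lemma dm_may_fail_two_layers:
  assumes "M \<ge> 1" and "test [] \<tau>\<^sub>1" and "test [\<tau>\<^sub>1] \<tau>\<^sub>2" and "\<not> test [\<tau>\<^sub>1, \<tau>\<^sub>2] \<tau>\<^sub>3"
  shows "dm_may_fail test M (replicate M \<tau>\<^sub>1 @ replicate M \<tau>\<^sub>2 @ [\<tau>\<^sub>3])"
proof -
  let ?P1 = "\<lambda>m. if m < M then [\<tau>\<^sub>1] else []"
  have "may_fail test M (\<lambda>m. if m < M then [\<tau>\<^sub>1] @ [\<tau>\<^sub>2] else ?P1 m) [\<tau>\<^sub>3]"
    using assms(4) by (intro may_fail.fail) simp
  then have "may_fail test M (\<lambda>m. if m < 0 then [\<tau>\<^sub>1] @ [\<tau>\<^sub>2] else ?P1 m)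
      (replicate (M - 0) \<tau>\<^sub>2 @ [\<tau>\<^sub>3])"
    using assms(3) by (intro may_fail_fill) auto
  then have "may_fail test M (\<lambda>m. if m < M then [] @ [\<tau>\<^sub>1] else []) (replicate M \<tau>\<^sub>2 @ [\<tau>\<^sub>3])"
    by (simp cong: if_cong)
  then have "may_fail test M (\<lambda>m. if m < 1 then [] @ [\<tau>\<^sub>1] else [])
      (replicate (M - 1) \<tau>\<^sub>1 @ replicate M \<tau>\<^sub>2 @ [\<tau>\<^sub>3])"
    using assms(1,2) by (intro may_fail_fill) auto
  moreover have "(\<lambda>m. if m < (1::nat) then [] @ [\<tau>\<^sub>1] else []) = (\<lambda>_. [])(0 := [\<tau>\<^sub>1])"
    by auto
  moreover have "replicate M \<tau>\<^sub>1 = \<tau>\<^sub>1 # replicate (M - 1) \<tau>\<^sub>1"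
    using assms(1) by (cases M) auto
  ultimately show ?thesis
    by (simp add: dm_may_fail_def)
qed

section \<open>Release counts and service received\<close>

text \<open>Cut the interval into cells of length \<open>T\<close> starting at \<open>x\<close>:
  separated points never share a cell, because the cell number \<open>f\<close> is strictly
  increasing on \<open>S\<close>. Counting cells gives the bound.\<close>

lemma separated_card_le:
  fixes S :: "real set"
  assumes "0 < T" and "S \<subseteq> {x..y}" and "x \<le> y"
    and sep: "\<And>r r'. r \<in> S \<Longrightarrow> r' \<in> S \<Longrightarrow> r < r' \<Longrightarrow> T \<le> r' - r"
  shows "finite S" and "real (card S) \<le> (y - x) / T + 1"
proof -
  define f where "f r = \<lfloor>(r - x) / T\<rfloor>" for r
  have less: "f r < f r'" if "r \<in> S" "r' \<in> S" "r < r'" for r r'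
  proof -
    have "(r - x + T) / T \<le> (r' - x) / T"
      using sep[OF that] \<open>0 < T\<close> by (intro divide_right_mono) auto
    then have "(r - x) / T + 1 \<le> (r' - x) / T"
      using \<open>0 < T\<close> by (simp add: add_divide_distrib)
    then show ?thesis unfolding f_def by linarith
  qed
  then have inj: "inj_on f S"
    by (metis inj_onI less_irrefl linorder_neqE_linordered_idom)
  have sub: "f ` S \<subseteq> {0..\<lfloor>(y - x) / T\<rfloor>}"
  proof
    fix z assume "z \<in> f ` S"
    then obtain r where "r \<in> S" and z: "z = f r" by blast
    then have r: "x \<le> r" "r \<le> y" using assms(2) by auto
    then have "0 \<le> (r - x) / T" "(r - x) / T \<le> (y - x) / T"
      using \<open>0 < T\<close> by (auto intro: divide_right_mono)
    then show "z \<in> {0..\<lfloor>(y - x) / T\<rfloor>}"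
      using z by (auto simp: f_def intro: floor_mono)
  qed
  then show "finite S"
    using inj finite_imageD finite_subset by blast
  have "card S = card (f ` S)"
    using inj by (simp add: card_image)
  also have "\<dots> \<le> card {0..\<lfloor>(y - x) / T\<rfloor>}"
    using sub by (intro card_mono) auto
  finally have "card S \<le> nat (\<lfloor>(y - x) / T\<rfloor> + 1)" by simp
  moreover have "0 \<le> (y - x) / T" using assms by simp
  ultimately show "real (card S) \<le> (y - x) / T + 1" by linarith
qed

lemma fp_schedule_measurable:
  "fp_schedule ts R e \<sigma> \<Longrightarrow> {s. \<sigma> s = Some J} \<in> sets borel"
  unfolding fp_schedule_def sets_lborel by (drule conjunct1) (erule spec)

lemma service_eq: "service \<sigma> J t = measure lborel ({0..<t} \<inter> {s. \<sigma> s = Some J})"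
  by (simp add: service_def Int_def)

lemma fmeasurable_Ico: "{x..<y :: real} \<in> fmeasurable lborel"
  using emeasure_bounded_finite[of "{x..<y}"] by (simp add: fmeasurable_def)

lemma fmeasurable_Int_Ico:
  fixes A :: "real set"
  assumes "A \<in> sets borel"
  shows "{x..<y} \<inter> A \<in> fmeasurable lborel"
  using assms fmeasurable_Ico by (intro fmeasurable_Int_fmeasurable) simp_all

lemma service_mono:
  assumes "fp_schedule ts R e \<sigma>" and "t \<le> t'"
  shows "service \<sigma> J t \<le> service \<sigma> J t'"
  unfolding service_eq using assms(2) fp_schedule_measurable[OF assms(1)]
  by (intro measure_mono_fmeasurable fmeasurable_Int_Ico) auto

lemma service_ge:
  assumes fp: "fp_schedule ts R e \<sigma>" and A: "A \<in> sets borel" "A \<subseteq> {0..<t}"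
    and run: "\<And>s. s \<in> A \<Longrightarrow> \<sigma> s = Some J"
  shows "measure lborel A \<le> service \<sigma> J t"
  unfolding service_eq using A run fp_schedule_measurable[OF fp]
  by (intro measure_mono_fmeasurable fmeasurable_Int_Ico) auto

lemma fp_schedule_at:
  assumes "fp_schedule ts R e \<sigma>" and "0 \<le> t"
  shows "case \<sigma> t of None \<Rightarrow> pending ts R e \<sigma> t = {}
    | Some J \<Rightarrow> J \<in> pending ts R e \<sigma> t \<and>
        (\<forall>J'\<in>pending ts R e \<sigma> t. J' \<noteq> J \<longrightarrow> precedes J J')"
  using assms unfolding fp_schedule_def by blast

lemma fp_schedule_SomeD:
  assumes "fp_schedule ts R e \<sigma>" and "0 \<le> t" and "\<sigma> t = Some J"
  shows "J \<in> pending ts R e \<sigma> t"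
    and "J' \<in> pending ts R e \<sigma> t \<Longrightarrow> J' \<noteq> J \<Longrightarrow> precedes J J'"
  using fp_schedule_at[OF assms(1,2)] by (simp_all add: assms(3))

lemma fp_schedule_busy:
  assumes "fp_schedule ts R e \<sigma>" and "0 \<le> t" and "J' \<in> pending ts R e \<sigma> t"
  obtains J where "\<sigma> t = Some J"
  using fp_schedule_at[OF assms(1,2)] assms(3) by (cases "\<sigma> t") auto

section \<open>Upper bounds on response times\<close>

text \<open>Releases are at least one execution time apart, so all earlier jobs of the task are
  complete when the job arrives. If it were late, it would be the only job allowed to run throughout
  \<open>{r..<r + C}\<close>, which already gives it enough service. Passing to an earlier job
  lowers the release time by at least \<open>C\<close>, hence the induction on \<open>n\<close> with
  \<open>r < real n * C\<close>.\<close>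

lemma top_priority_completes:
  assumes fp: "fp_schedule ts R e \<sigma>" and rel: "legal_releases ts R"
    and ex: "legal_execution ts R e" and ne: "0 < length ts"
    and pos: "0 < wcet (ts ! 0)" and per: "ereal (wcet (ts ! 0)) \<le> period (ts ! 0)"
    and r: "r \<in> R 0"
  shows "e (0, r) \<le> service \<sigma> (0, r) (r + wcet (ts ! 0))"
proof -
  define C where "C = wcet (ts ! 0)"
  have "e (0, r) \<le> service \<sigma> (0, r) (r + C)" if "r \<in> R 0" "r < real n * C" for n r
    using that
  proof (induction n arbitrary: r)
    case 0
    then show ?case using rel ne by (force simp: legal_releases_def)
  next
    case (Suc n)
    have r0: "0 \<le> r" using rel ne Suc.prems by (auto simp: legal_releases_def)
    have earlier: "e (0, r') \<le> service \<sigma> (0, r') s" if "r' \<in> R 0" "r' < r" "r \<le> s" for r' s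
    proof -
      have "ereal C \<le> ereal (r - r')"
        using rel ne Suc.prems that per unfolding legal_releases_def C_def
        by (meson order_trans)
      then have *: "r' + C \<le> r" by simp
      then have "e (0, r') \<le> service \<sigma> (0, r') (r' + C)"
        using Suc.prems that by (intro Suc.IH) (auto simp: algebra_simps)
      also have "\<dots> \<le> service \<sigma> (0, r') s"
        using * that by (intro service_mono[OF fp]) simp
      finally show ?thesis .
    qed
    show ?case
    proof (rule ccontr)
      assume "\<not> ?case"
      then have late: "service \<sigma> (0, r) (r + C) < e (0, r)" by simp
      have run: "\<sigma> s = Some (0, r)" if s: "s \<in> {r..<r + C}" for s
      proof -
        have "service \<sigma> (0, r) s < e (0, r)"
          using late service_mono[OF fp, of s "r + C" "(0, r)"] s by simp
        then have p: "(0, r) \<in> pending ts R e \<sigma> s"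
          using Suc.prems s ne by (auto simp: pending_def)
        then obtain i r' where J: "\<sigma> s = Some (i, r')"
          using fp_schedule_busy[OF fp _ p] s r0 by (metis atLeastLessThan_iff order_trans surj_pair)
        have s0: "0 \<le> s" using s r0 by simp
        have q: "(i, r') \<in> pending ts R e \<sigma> s"
          using fp_schedule_SomeD(1)[OF fp s0 J] .
        show ?thesis
        proof (rule ccontr)
          assume "\<sigma> s \<noteq> Some (0, r)"
          then have "precedes (i, r') (0, r)"
            using fp_schedule_SomeD(2)[OF fp s0 J p] J by auto
          then have "i = 0" "r' < r" by (auto simp: precedes_def)
          then show False using q earlier[of r' s] s by (auto simp: pending_def)
        qed
      qed
      have "C \<le> service \<sigma> (0, r) (r + C)"
        using service_ge[OF fp, of "{r..<r + C}" "r + C" "(0, r)"] run r0 pos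
        by (simp add: C_def)
      moreover have "e (0, r) \<le> C"
        using ex ne Suc.prems by (auto simp: legal_execution_def C_def)
      ultimately show False using late by simp
    qed
  qed
  moreover obtain n where "r < real n * C"
    using pos reals_Archimedean3 by (auto simp: C_def)
  ultimately show ?thesis using r by (auto simp: C_def)
qed

lemma response_time_le:
  assumes "e (k, r) \<le> service \<sigma> (k, r) (r + d)"
  shows "response_time e \<sigma> (k, r) \<le> ereal d"
proof -
  have "Inf {ereal t |t. e (k, r) \<le> service \<sigma> (k, r) t} \<le> ereal (r + d)"
    using assms by (intro Inf_lower) blast
  then have "response_time e \<sigma> (k, r) \<le> ereal (r + d) - ereal r"
    unfolding response_time_def snd_conv by (rule ereal_minus_mono) (rule order_refl)
  then show ?thesis by simp
qed

lemma wcrt_le: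
  assumes "\<And>R e \<sigma> r. legal_releases ts R \<Longrightarrow> legal_execution ts R e \<Longrightarrow> fp_schedule ts R e \<sigma> \<Longrightarrow>
    r \<in> R k \<Longrightarrow> e (k, r) \<le> service \<sigma> (k, r) (r + d)"
  shows "wcrt ts k \<le> ereal d"
  unfolding wcrt_def
proof (intro Sup_least, elim CollectE exE conjE)
  fix x R e \<sigma> r
  assume "x = response_time e \<sigma> (k, r)"
    and "legal_releases ts R" "legal_execution ts R e" "fp_schedule ts R e \<sigma>" "r \<in> R k"
  then show "x \<le> ereal d" using response_time_le assms by metis
qed

lemma wcrt_top_priority:
  assumes "0 < length ts" and "0 < wcet (ts ! 0)" and "ereal (wcet (ts ! 0)) \<le> period (ts ! 0)"
  shows "wcrt ts 0 \<le> ereal (wcet (ts ! 0))"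
  by (intro wcrt_le top_priority_completes[OF _ _ _ assms])

text \<open>If the single job were late, it would be pending throughout the window of length
  \<open>d\<close>, so every instant there would serve either this job or a top-priority job. The
  releases that matter lie in an interval of length \<open>d + C\<close>, and each costs at most
  \<open>C\<close>; by \<open>fits\<close> what remains of the window suffices for the single
  job.\<close>

lemma wcrt_single_job:
  assumes C: "0 < C" "C \<le> T" and d: "0 \<le> d" and fits: "c + C * ((d + C) / T + 1) \<le> d"
  shows "wcrt [Task C (ereal T) d\<^sub>1, Task c \<infinity> d\<^sub>2] 1 \<le> ereal d"
proof -
  let ?ts = "[Task C (ereal T) d\<^sub>1, Task c \<infinity> d\<^sub>2]"
  have "e (1, r) \<le> service \<sigma> (1, r) (r + d)"
    if rel: "legal_releases ?ts R" and ex: "legal_execution ?ts R e"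
      and fp: "fp_schedule ?ts R e \<sigma>" and r: "r \<in> R 1" for R e \<sigma> r
  proof (rule ccontr)
    assume "\<not> ?thesis"
    then have late: "service \<sigma> (1, r) (r + d) < e (1, r)" by simp
    have r0: "0 \<le> r" using rel r by (auto simp: legal_releases_def)
    have sep: "period (?ts ! i) \<le> ereal (r'' - r')" if "i < 2" "r' \<in> R i" "r'' \<in> R i" "r' < r''" for i r' r''
      using rel that unfolding legal_releases_def by simp
    \<comment> \<open>An infinite period is never at most a real difference, so a second release is
      impossible.\<close>
    have only: "r' = r" if "r' \<in> R 1" for r'
      using sep[of 1 r r'] sep[of 1 r' r] r that by (cases r r' rule: linorder_cases) simp_all
    \<comment> \<open>Top-priority jobs released before \<open>r - C\<close> are complete when the
      window opens.\<close>
    define S where "S = R 0 \<inter> {r - C..r + d}"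
    have "T \<le> r'' - r'" if "r' \<in> S" "r'' \<in> S" "r' < r''" for r' r''
      using sep[of 0 r' r''] that by (simp add: S_def)
    then have finS: "finite S" and "real (card S) \<le> ((r + d) - (r - C)) / T + 1"
      using separated_card_le[of T S "r - C" "r + d"] C d by (auto simp: S_def)
    then have cardS: "real (card S) \<le> (d + C) / T + 1" by simp
    have top: "s < r' + C" "r' \<le> s" "r' \<in> R 0" if "\<sigma> s = Some (0, r')" "0 \<le> s" for s r'
    proof -
      have p: "(0, r') \<in> pending ?ts R e \<sigma> s"
        using fp_schedule_SomeD(1)[OF fp that(2,1)] .
      then show "r' \<le> s" "r' \<in> R 0" by (auto simp: pending_def)
      then have "e (0, r') \<le> service \<sigma> (0, r') (r' + C)"
        using top_priority_completes[OF fp rel ex] C by simp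
      moreover have "service \<sigma> (0, r') s < e (0, r')"
        using p by (auto simp: pending_def)
      ultimately show "s < r' + C"
        using service_mono[OF fp, of "r' + C" s "(0, r')"] by linarith
    qed
    define A where "A = {r..<r + d} \<inter> {s. \<sigma> s = Some (1, r)}"
    \<comment> \<open>Each top-priority job is charged the whole interval to which
      \<open>top\<close> confines it.\<close>
    define B where "B = (\<Union>r'\<in>S. {r'..<r' + C})"
    have cover: "{r..<r + d} \<subseteq> A \<union> B"
    proof
      fix s assume s: "s \<in> {r..<r + d}"
      have s0: "0 \<le> s" using s r0 by simp
      have "service \<sigma> (1, r) s < e (1, r)"
        using late service_mono[OF fp, of s "r + d" "(1, r)"] s by simp
      then have p: "(1, r) \<in> pending ?ts R e \<sigma> s"
        using r s by (auto simp: pending_def)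
      then obtain i r' where J: "\<sigma> s = Some (i, r')"
        using fp_schedule_busy[OF fp s0 p] by (metis surj_pair)
      have "(i, r') \<in> pending ?ts R e \<sigma> s"
        using fp_schedule_SomeD(1)[OF fp s0 J] .
      then have "i = 0 \<or> i = 1 \<and> r' \<in> R 1" by (auto simp: pending_def less_Suc_eq)
      then show "s \<in> A \<union> B"
      proof
        assume "i = 0"
        then show ?thesis using top[of s r'] J s0 s by (auto simp: B_def S_def intro!: bexI[of _ r'])
      next
        assume "i = 1 \<and> r' \<in> R 1"
        then show ?thesis using J s only by (auto simp: A_def)
      qed
    qed
    have mA: "A \<in> fmeasurable lborel"
      unfolding A_def by (intro fmeasurable_Int_Ico fp_schedule_measurable[OF fp])
    have mB: "B \<in> fmeasurable lborel"
      unfolding B_def using finS by (intro fmeasurable.finite_UN fmeasurable_Ico)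
    have "d = measure lborel {r..<r + d}" using d by simp
    also have "\<dots> \<le> measure lborel (A \<union> B)"
      using cover mA mB by (intro measure_mono_fmeasurable fmeasurable.Un) auto
    also have "\<dots> \<le> measure lborel A + measure lborel B"
      using mA mB by (intro measure_Un_le) (auto dest: fmeasurableD)
    also have "measure lborel A \<le> service \<sigma> (1, r) (r + d)"
      using mA r0 by (intro service_ge[OF fp]) (auto simp: A_def dest: fmeasurableD)
    also have "measure lborel B \<le> (\<Sum>r'\<in>S. measure lborel {r'..<r' + C})"
      unfolding B_def using finS by (intro measure_UNION_le) auto
    also have "\<dots> = real (card S) * C" using C by simp
    also have "\<dots> \<le> ((d + C) / T + 1) * C"
      using cardS C by (intro mult_right_mono) auto
    finally have "d \<le> service \<sigma> (1, r) (r + d) + ((d + C) / T + 1) * C" by simp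
    moreover have "e (1, r) \<le> wcet (?ts ! 1)"
      using ex[unfolded legal_execution_def, rule_format, of 1 r] r by simp
    ultimately show False using late fits by (simp add: mult.commute)
  qed
  then show ?thesis by (rule wcrt_le)
qed

section \<open>A schedule with a late job\<close>

text \<open>Gap \<open>k\<close> is what a task of period 1 and execution time \<open>u\<close>,
  released at the natural numbers with top priority, leaves of \<open>{k..<k + 1}\<close>.\<close>

definition gaps :: "real \<Rightarrow> nat \<Rightarrow> nat \<Rightarrow> real set" where
  "gaps u i j = (\<Union>k\<in>{i..<j}. {real k + u..<real k + 1})"

lemma mem_gaps_iff:
  assumes "0 \<le> u" and "0 \<le> t"
  shows "t \<in> gaps u i j \<longleftrightarrow> u \<le> frac t \<and> int i \<le> \<lfloor>t\<rfloor> \<and> \<lfloor>t\<rfloor> < int j"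
proof
  assume "t \<in> gaps u i j"
  then obtain k where k: "i \<le> k" "k < j" "real k + u \<le> t" "t < real k + 1"
    by (auto simp: gaps_def)
  then have "\<lfloor>t\<rfloor> = int k" using assms by (intro floor_unique) auto
  then show "u \<le> frac t \<and> int i \<le> \<lfloor>t\<rfloor> \<and> \<lfloor>t\<rfloor> < int j"
    using k by (simp add: frac_def)
next
  assume *: "u \<le> frac t \<and> int i \<le> \<lfloor>t\<rfloor> \<and> \<lfloor>t\<rfloor> < int j"
  then have "t \<in> {real (nat \<lfloor>t\<rfloor>) + u..<real (nat \<lfloor>t\<rfloor>) + 1}"
    using assms by (auto simp: frac_def)
  moreover have "nat \<lfloor>t\<rfloor> \<in> {i..<j}" using * by auto
  ultimately show "t \<in> gaps u i j" unfolding gaps_def by blast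
qed

lemma fmeasurable_gaps: "gaps u i j \<in> fmeasurable lborel"
  unfolding gaps_def by (intro fmeasurable.finite_UN fmeasurable_Ico) simp

lemma measure_gaps:
  assumes "0 \<le> u" and "u \<le> 1" and "i \<le> j"
  shows "measure lborel (gaps u i j) = real (j - i) * (1 - u)"
proof -
  have "disjoint_family_on (\<lambda>k. {real k + u..<real k + 1}) {i..<j}"
    unfolding disjoint_family_on_def
  proof (intro ballI impI)
    fix k l :: nat assume "k \<noteq> l"
    then have "real k + 1 \<le> real l \<or> real l + 1 \<le> real k" by linarith
    then show "{real k + u..<real k + 1} \<inter> {real l + u..<real l + 1} = {}"
      using assms by auto
  qed
  moreover have "emeasure lborel {real k + u..<real k + 1} \<noteq> \<infinity>" for k
    using fmeasurable_Ico[of "real k + u" "real k + 1"] by (auto simp: fmeasurable_def)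
  ultimately have "measure lborel (gaps u i j) = (\<Sum>k\<in>{i..<j}. measure lborel {real k + u..<real k + 1})"
    unfolding gaps_def by (intro measure_finite_Union image_subsetI) simp_all
  also have "\<dots> = real (j - i) * (1 - u)" using assms by simp
  finally show ?thesis .
qed

text \<open>A job served exactly in these gaps and requiring their total length completes at
  \<open>j\<close>, not earlier: before \<open>j\<close>, a piece of the last gap is still
  missing.\<close>

lemma measure_initial_gaps:
  assumes "0 \<le> u" and "u < 1" and "i < j"
  shows "measure lborel ({0..<t} \<inter> gaps u i j) < real (j - i) * (1 - u) \<longleftrightarrow> t < real j"
proof
  assume "measure lborel ({0..<t} \<inter> gaps u i j) < real (j - i) * (1 - u)"
  moreover have "{0..<t} \<inter> gaps u i j = gaps u i j" if "real j \<le> t"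
    using that assms by (force simp: gaps_def)
  ultimately show "t < real j" using measure_gaps[of u i j] assms by fastforce
next
  assume t: "t < real j"
  \<comment> \<open>The part of the last gap from \<open>t\<close> on, of positive length as
    \<open>t < real j\<close> and \<open>u < 1\<close>.\<close>
  define I where "I = {max t (real (j - 1) + u)..<real j}"
  have I: "I \<subseteq> gaps u i j"
    unfolding gaps_def I_def using assms
    by (intro UN_upper[THEN order_trans[rotated], of "j - 1"]) (auto simp: of_nat_diff)
  have "measure lborel ({0..<t} \<inter> gaps u i j) \<le> measure lborel (gaps u i j - I)"
    using fmeasurable_gaps[of u i j] fmeasurable_Ico
    by (intro measure_mono_fmeasurable fmeasurable.Diff) (auto simp: I_def dest: fmeasurableD)
  also have "\<dots> = measure lborel (gaps u i j) - measure lborel I"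
    using fmeasurable_gaps[of u i j] I by (intro measurable_measure_Diff) (auto simp: I_def)
  finally have "measure lborel ({0..<t} \<inter> gaps u i j) \<le> real (j - i) * (1 - u) - measure lborel I"
    using measure_gaps[of u i j] assms by simp
  moreover have "measure lborel I > 0"
    unfolding I_def using t assms by (simp add: of_nat_diff)
  ultimately show "measure lborel ({0..<t} \<inter> gaps u i j) < real (j - i) * (1 - u)"
    by linarith
qed

lemma frac_less_floor_eq_iff:
  assumes "u \<le> 1"
  shows "frac t < u \<and> of_int \<lfloor>t\<rfloor> = real k \<longleftrightarrow> t \<in> {real k..<real k + u}"
proof
  assume *: "t \<in> {real k..<real k + u}"
  then have "\<lfloor>t\<rfloor> = int k" using assms by (intro floor_unique) auto
  then show "frac t < u \<and> of_int \<lfloor>t\<rfloor> = real k" using * by (simp add: frac_def)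
next
  assume *: "frac t < u \<and> of_int \<lfloor>t\<rfloor> = real k"
  then show "t \<in> {real k..<real k + u}"
    using of_int_floor_le[of t] by (simp add: frac_def del: of_int_floor_le)
qed

text \<open>The run after a synchronous release: the job of task 1 gets the first \<open>a\<close>
  gaps, that of task 2 the next \<open>b\<close>. The floor of \<open>t\<close> is the release time
  of the current periodic job.\<close>

definition gap_schedule :: "real \<Rightarrow> nat \<Rightarrow> nat \<Rightarrow> schedule" where
  "gap_schedule u a b t =
     (if t < 0 then None else if frac t < u then Some (0, of_int \<lfloor>t\<rfloor>)
      else if \<lfloor>t\<rfloor> < int a then Some (1, 0)
      else if \<lfloor>t\<rfloor> < int (a + b) then Some (2, 0) else None)"

lemma gap_schedule_sets:
  assumes "0 < u" and "u < 1"
  shows "{s. gap_schedule u a b s = Some (0, real k)} = {real k..<real k + u}"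
    and "{s. gap_schedule u a b s = Some (1, 0)} = gaps u 0 a"
    and "{s. gap_schedule u a b s = Some (2, 0)} = gaps u a (a + b)"
proof -
  have nonneg: "0 \<le> s" if "s \<in> gaps u i j" for s i j
    using that assms by (auto simp: gaps_def)
  have "gap_schedule u a b s = Some (0, real k) \<longleftrightarrow> s \<in> {real k..<real k + u}" for s
  proof -
    have "0 \<le> s" if "of_int \<lfloor>s\<rfloor> = real k" using that by linarith
    then show ?thesis
      unfolding frac_less_floor_eq_iff[OF less_imp_le[OF assms(2)], symmetric]
      by (auto simp: gap_schedule_def)
  qed
  then show "{s. gap_schedule u a b s = Some (0, real k)} = {real k..<real k + u}"
    by blast
  have "gap_schedule u a b s = Some (1, 0) \<longleftrightarrow> s \<in> gaps u 0 a" for s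
  proof (cases "s < 0")
    case True
    then show ?thesis using nonneg[of s 0 a] by (auto simp: gap_schedule_def)
  next
    case False
    then have "s \<in> gaps u 0 a \<longleftrightarrow> u \<le> frac s \<and> int 0 \<le> \<lfloor>s\<rfloor> \<and> \<lfloor>s\<rfloor> < int a"
      using assms by (intro mem_gaps_iff) auto
    then show ?thesis using False by (auto simp: gap_schedule_def)
  qed
  then show "{s. gap_schedule u a b s = Some (1, 0)} = gaps u 0 a"
    by blast
  have "gap_schedule u a b s = Some (2, 0) \<longleftrightarrow> s \<in> gaps u a (a + b)" for s
  proof (cases "s < 0")
    case True
    then show ?thesis using nonneg[of s a "a + b"] by (auto simp: gap_schedule_def)
  next
    case False
    then have "s \<in> gaps u a (a + b) \<longleftrightarrow> u \<le> frac s \<and> int a \<le> \<lfloor>s\<rfloor> \<and> \<lfloor>s\<rfloor> < int (a + b)"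
      using assms by (intro mem_gaps_iff) auto
    then show ?thesis using False by (auto simp: gap_schedule_def)
  qed
  then show "{s. gap_schedule u a b s = Some (2, 0)} = gaps u a (a + b)"
    by blast
qed

text \<open>\<open>J\<close> ranges over all pairs, but only the jobs of
  \<open>gap_schedule_sets\<close> ever run; for the others the set is empty.\<close>

lemma gap_schedule_measurable:
  assumes "0 < u" and "u < 1"
  shows "{s. gap_schedule u a b s = Some J} \<in> sets lborel"
proof (cases "(\<exists>k. J = (0, real k)) \<or> J = (1, 0) \<or> J = (2, 0)")
  case True
  then show ?thesis
    using gap_schedule_sets[OF assms] fmeasurable_gaps[THEN fmeasurableD] by auto
next
  case False
  have "gap_schedule u a b s \<noteq> Some J" for s
  proof
    assume J: "gap_schedule u a b s = Some J"
    then have "0 \<le> s" by (simp add: gap_schedule_def split: if_splits)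
    then have "(of_int \<lfloor>s\<rfloor> :: real) = real (nat \<lfloor>s\<rfloor>)" by simp
    moreover have "J = (0, of_int \<lfloor>s\<rfloor>) \<or> J = (1, 0) \<or> J = (2, 0)"
      using J by (simp add: gap_schedule_def split: if_splits)
    ultimately show False using False by metis
  qed
  then show ?thesis by simp
qed

text \<open>In the synchronous run with worst-case execution times, the job of the third task takes
  the last \<open>b\<close> of the first \<open>a + b\<close> gaps and so completes exactly at
  \<open>a + b\<close>.\<close>

lemma wcrt_gap_schedule:
  assumes u: "0 < u" "u < 1" and ab: "0 < a" "0 < b"
  shows "ereal (real (a + b)) \<le>
    wcrt [Task u 1 d\<^sub>0, Task (real a * (1 - u)) p\<^sub>1 d\<^sub>1, Task (real b * (1 - u)) p\<^sub>2 d\<^sub>2] 2"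
proof -
  let ?ts = "[Task u 1 d\<^sub>0, Task (real a * (1 - u)) p\<^sub>1 d\<^sub>1, Task (real b * (1 - u)) p\<^sub>2 d\<^sub>2]"
  define \<sigma> where "\<sigma> = gap_schedule u a b"
  define R where "R i = (if i = 0 then \<nat> else {0::real})" for i :: nat
  define e where "e J = wcet (?ts ! fst J)" for J :: job
  have nth: "i < length ?ts \<longleftrightarrow> i = 0 \<or> i = 1 \<or> i = 2" for i by auto
  have rel: "legal_releases ?ts R"
    unfolding legal_releases_def nth by (auto simp: R_def Nats_def one_ereal_def)
  have ex: "legal_execution ?ts R e"
    unfolding legal_execution_def nth using u ab by (auto simp: e_def)
  \<comment> \<open>\<open>s0\<close>, \<open>s1\<close> and \<open>s2\<close> express
    incompleteness by \<open>t\<close> alone; this makes the pending set explicit, and the priority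
    rule becomes a case analysis.\<close>
  have s0: "service \<sigma> (0, real k) t < u \<longleftrightarrow> t < real k + u" for k t
  proof -
    have "{0..<t} \<inter> {real k..<real k + u} = {real k..<min t (real k + u)}" by auto
    then have "service \<sigma> (0, real k) t = (if t < real k then 0 else min t (real k + u) - real k)"
      using u by (auto simp: service_eq \<sigma>_def gap_schedule_sets)
    then show ?thesis using u by auto
  qed
  have s1: "service \<sigma> (1, 0) t < real a * (1 - u) \<longleftrightarrow> t < real a" for t
    unfolding service_eq \<sigma>_def gap_schedule_sets[OF u]
    using measure_initial_gaps[of u 0 a t] u ab by simp
  have s2: "service \<sigma> (2, 0) t < real b * (1 - u) \<longleftrightarrow> t < real (a + b)" for t
    unfolding service_eq \<sigma>_def gap_schedule_sets[OF u]
    using measure_initial_gaps[of u a "a + b" t] u ab by simp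
  have pending: "pending ?ts R e \<sigma> t =
      {(i, r). i = 0 \<and> frac t < u \<and> r = of_int \<lfloor>t\<rfloor> \<or> i = 1 \<and> t < real a \<and> r = 0
        \<or> i = 2 \<and> t < real (a + b) \<and> r = 0}"
    if t: "0 \<le> t" for t
  proof -
    have fl: "real k \<le> t \<and> t < real k + u \<longleftrightarrow> frac t < u \<and> real k = of_int \<lfloor>t\<rfloor>" for k
      using frac_less_floor_eq_iff[of u t k] u by auto
    have "of_int \<lfloor>t\<rfloor> \<in> (\<nat> :: real set)"
      using t by (metis of_nat_in_Nats of_int_of_nat_eq zero_le_floor int_nat_eq)
    then have "(0, r) \<in> pending ?ts R e \<sigma> t \<longleftrightarrow> frac t < u \<and> r = of_int \<lfloor>t\<rfloor>" for r
      using s0 fl by (auto simp: pending_def R_def e_def elim!: Nats_cases) (metis Nats_cases)+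
    moreover have "(1, r) \<in> pending ?ts R e \<sigma> t \<longleftrightarrow> t < real a \<and> r = 0" for r
      using s1 t by (auto simp: pending_def R_def e_def)
    moreover have "(2, r) \<in> pending ?ts R e \<sigma> t \<longleftrightarrow> t < real (a + b) \<and> r = 0" for r
      using s2 t by (auto simp: pending_def R_def e_def)
    moreover have "i = 0 \<or> i = 1 \<or> i = 2" if "(i, r) \<in> pending ?ts R e \<sigma> t" for i r
      using that nth by (auto simp: pending_def)
    ultimately have "(i, r) \<in> pending ?ts R e \<sigma> t \<longleftrightarrow>
        i = 0 \<and> frac t < u \<and> r = of_int \<lfloor>t\<rfloor> \<or> i = 1 \<and> t < real a \<and> r = 0
          \<or> i = 2 \<and> t < real (a + b) \<and> r = 0" for i r
      by metis
    then show ?thesis by blast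
  qed
  have "fp_schedule ?ts R e \<sigma>"
    unfolding fp_schedule_def
  proof (intro conjI allI impI)
    show "{s. \<sigma> s = Some J} \<in> sets lborel" for J
      unfolding \<sigma>_def by (rule gap_schedule_measurable[OF u])
    fix t :: real assume t: "0 \<le> t"
    \<comment> \<open>\<open>gap_schedule\<close> switches on floors, \<open>pending\<close> on
      \<open>t\<close>; they agree because the switching points are integers.\<close>
    have "t < real a \<longleftrightarrow> \<lfloor>t\<rfloor> < int a" "t < real (a + b) \<longleftrightarrow> \<lfloor>t\<rfloor> < int (a + b)"
      by linarith+
    then show "case \<sigma> t of None \<Rightarrow> pending ?ts R e \<sigma> t = {}
        | Some J \<Rightarrow> J \<in> pending ?ts R e \<sigma> t \<and> (\<forall>J'\<in>pending ?ts R e \<sigma> t. J' \<noteq> J \<longrightarrow> precedes J J')"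
      unfolding pending[OF t] using t
      by (auto simp: \<sigma>_def gap_schedule_def precedes_def)
  qed
  then have "legal_releases ?ts R \<and> legal_execution ?ts R e \<and> fp_schedule ?ts R e \<sigma> \<and> 0 \<in> R 2"
    using rel ex by (simp add: R_def)
  then have "response_time e \<sigma> (2, 0) \<le> wcrt ?ts 2"
    unfolding wcrt_def by (intro Sup_upper) blast
  moreover have "ereal (real (a + b)) \<le> response_time e \<sigma> (2, 0)"
  proof -
    have "real (a + b) \<le> t" if "e (2, 0) \<le> service \<sigma> (2, 0) t" for t
      using that s2[of t] by (simp add: e_def del: of_nat_add)
    then have "ereal (real (a + b)) \<le> Inf {ereal t |t. e (2, 0) \<le> service \<sigma> (2, 0) t}"
      by (intro Inf_greatest) (auto simp del: of_nat_add)
    then show ?thesis by (simp add: response_time_def zero_ereal_def[symmetric])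
  qed
  ultimately show ?thesis by (rule order_trans[rotated])
qed

section \<open>Parameters, test results and the bound on \<open>Lam\<close>\<close>

theorem theorem4:
  fixes M :: nat and \<gamma> :: real
  assumes "M \<ge> 1" and "0 < \<gamma>" and "\<gamma> < 3 - 3 / (real M + 1)"
  shows "(\<exists>ts. task_set ts \<and>
             (\<forall>test \<in> {linear_test, quadratic_test, exact_test}. dm_may_fail test M ts) \<and>
             Lam M ts \<le> ereal (1 / (3 - 3 / (real M + 1) - \<gamma>))) \<and>
         (\<forall>test \<in> {linear_test, quadratic_test, exact_test}.
             speedup_factor test M \<ge> ereal (3 - 3 / (real M + 1) - \<gamma>))"
proof -
  define \<rho> where "\<rho> = 3 - 3 / (real M + 1) - \<gamma>"
  \<comment> \<open>The reciprocal of \<open>3 - 3 / (M + 1)\<close>.\<close>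
  define L where "L = (real M + 1) / (3 * real M)"
  define n a b where "n = 12 * M - 4" and "a = 6 * M - 5" and "b = 6 * M + 2"
  \<comment> \<open>Tuned so that \<open>n = 18 * M * (1 - u)\<close>. Then
    \<open>L * n = (6 * M + 6) * (1 - u)\<close> can be compared with the execution times by
    comparing the factors of \<open>1 - u\<close>.\<close>
  define u where "u = (3 * real M + 2) / (9 * real M)"
  define \<tau>\<^sub>1 where "\<tau>\<^sub>1 = Task u 1 (real n)"
  define \<tau>\<^sub>2 where "\<tau>\<^sub>2 = Task (real a * (1 - u)) \<infinity> (real n)"
  define \<tau>\<^sub>3 where "\<tau>\<^sub>3 = Task (real b * (1 - u)) \<infinity> (real n)"
  define ts where "ts = replicate M \<tau>\<^sub>1 @ replicate M \<tau>\<^sub>2 @ [\<tau>\<^sub>3]"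
  have M1: "1 \<le> real M" using assms(1) by simp
  have real_nab: "real n = 12 * real M - 4" "real a = 6 * real M - 5" "real b = 6 * real M + 2"
    using assms(1) by (auto simp: n_def a_def b_def of_nat_diff)
  have ab: "a + b = n + 1" "0 < a" "0 < b" using assms(1) by (auto simp: n_def a_def b_def)
  have n8: "8 \<le> real n" using M1 real_nab by simp
  have u: "0 < u" "u < 1" "u \<le> 5 / 9" using M1 by (auto simp: u_def field_simps)
  \<comment> \<open>The task set achieves the bound \<open>L\<close> independently of
    \<open>\<gamma>\<close>, which only lowers \<open>\<rho>\<close> below
    \<open>1 / L\<close>.\<close>
  have \<rho>: "0 < \<rho>" "L \<le> 1 / \<rho>"
  proof -
    show "0 < \<rho>" using assms(3) by (simp add: \<rho>_def)
    have "\<rho> * L \<le> (3 - 3 / (real M + 1)) * L"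
      using assms(2) M1 by (intro mult_right_mono) (auto simp: \<rho>_def L_def)
    also have "3 - 3 / (real M + 1) = 3 * real M / (real M + 1)"
      using M1 by (simp add: field_simps)
    also have "\<dots> * L = 1" using M1 by (auto simp: L_def)
    finally show "L \<le> 1 / \<rho>" using \<open>0 < \<rho>\<close> by (simp add: field_simps)
  qed
  have period_1: "over_period x \<tau>\<^sub>1 = x" "util \<tau>\<^sub>1 = u" for x
    by (simp_all add: over_period_def util_def \<tau>\<^sub>1_def one_ereal_def)
  have period_inf: "over_period x \<tau>\<^sub>2 = 0" "util \<tau>\<^sub>2 = 0" "util \<tau>\<^sub>3 = 0" for x
    by (simp_all add: over_period_def util_def \<tau>\<^sub>2_def \<tau>\<^sub>3_def)
  have wcets: "wcet \<tau>\<^sub>1 = u" "wcet \<tau>\<^sub>2 = real a * (1 - u)" "wcet \<tau>\<^sub>3 = real b * (1 - u)"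
    and deadlines: "deadline \<tau>\<^sub>1 = real n" "deadline \<tau>\<^sub>2 = real n" "deadline \<tau>\<^sub>3 = real n"
    by (simp_all add: \<tau>\<^sub>1_def \<tau>\<^sub>2_def \<tau>\<^sub>3_def)
  have uu: "0 < u * u" "u * u < 1" using u mult_strict_mono[of u 1 u 1] by auto
  \<comment> \<open>The strongest of the three conditions for accepting
    \<open>\<tau>\<^sub>2\<close>, in the form needed by \<open>wcrt_single_job\<close>: the linear
    test lacks the term \<open>u * u\<close>, the quadratic one subtracts it. The factors 7 and 4/9
    are \<open>n - a\<close> and \<open>1 - u\<close> at \<open>M = 1\<close>, where both are
    least.\<close>
  have fits: "real a * (1 - u) + u * (real n + u + 1) \<le> real n"
  proof -
    have "7 * (4 / 9) \<le> (real n - real a) * (1 - u)"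
      using u M1 real_nab by (intro mult_mono) auto
    then show ?thesis using u uu by (simp add: algebra_simps)
  qed
  have "u * (real n + u + 1) = u * real n + u * u + u" by (simp add: algebra_simps)
  then have fits': "real a * (1 - u) + u + u * real n \<le> real n"
      "real a * (1 - u) + u * real n + u - u * u \<le> real n"
    using fits uu by linarith+
  \<comment> \<open>This is the left-hand side of the linear test for \<open>\<tau>\<^sub>3\<close>,
    which thus exceeds \<open>n\<close> by 1. The quadratic test exceeds it by
    \<open>1 - u * u\<close>, still positive.\<close>
  have overload: "real a * (1 - u) + real b * (1 - u) + (1 + real n) * u = real n + 1"
  proof -
    have "real a + real b = real n + 1" using ab(1) by linarith
    then have "(real a + real b) * (1 - u) + (1 + real n) * u = real n + 1"
      by (simp add: algebra_simps)
    then show ?thesis by (simp add: algebra_simps)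
  qed
  have lin: "linear_test [] \<tau>\<^sub>1" "linear_test [\<tau>\<^sub>1] \<tau>\<^sub>2" "\<not> linear_test [\<tau>\<^sub>1, \<tau>\<^sub>2] \<tau>\<^sub>3"
    using u n8 fits'(1) overload uu
    by (simp_all add: linear_test_def period_1 period_inf wcets deadlines algebra_simps)
  have quad: "quadratic_test [] \<tau>\<^sub>1" "quadratic_test [\<tau>\<^sub>1] \<tau>\<^sub>2" "\<not> quadratic_test [\<tau>\<^sub>1, \<tau>\<^sub>2] \<tau>\<^sub>3"
    using u n8 fits'(2) overload uu
    by (simp_all add: quadratic_test_def period_1 period_inf wcets deadlines algebra_simps)
  have exact: "exact_test [] \<tau>\<^sub>1" "exact_test [\<tau>\<^sub>1] \<tau>\<^sub>2" "\<not> exact_test [\<tau>\<^sub>1, \<tau>\<^sub>2] \<tau>\<^sub>3"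
  proof -
    have "wcrt [\<tau>\<^sub>1] 0 \<le> ereal u"
      using wcrt_top_priority[of "[\<tau>\<^sub>1]"] u by (simp add: \<tau>\<^sub>1_def one_ereal_def)
    also have "\<dots> \<le> ereal (real n)" using u n8 by simp
    finally show "exact_test [] \<tau>\<^sub>1" by (simp add: exact_test_def deadlines)
    have "wcrt [\<tau>\<^sub>1, \<tau>\<^sub>2] 1 \<le> ereal (real n)"
      using wcrt_single_job[of u 1 "real n" "real a * (1 - u)"] u fits
      by (simp add: \<tau>\<^sub>1_def \<tau>\<^sub>2_def one_ereal_def)
    then show "exact_test [\<tau>\<^sub>1] \<tau>\<^sub>2" by (simp add: exact_test_def deadlines)
    have "ereal (real (a + b)) \<le> wcrt [\<tau>\<^sub>1, \<tau>\<^sub>2, \<tau>\<^sub>3] 2"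
      unfolding \<tau>\<^sub>1_def \<tau>\<^sub>2_def \<tau>\<^sub>3_def using u ab by (intro wcrt_gap_schedule)
    moreover have "ereal (real n) < ereal (real (a + b))" using ab by simp
    ultimately have "ereal (real n) < wcrt [\<tau>\<^sub>1, \<tau>\<^sub>2, \<tau>\<^sub>3] 2" by order
    then show "\<not> exact_test [\<tau>\<^sub>1, \<tau>\<^sub>2] \<tau>\<^sub>3"
      by (simp add: exact_test_def deadlines numeral_2_eq_2)
  qed
  have may_fail: "dm_may_fail test M ts" if "test \<in> {linear_test, quadratic_test, exact_test}" for test
    using that lin quad exact dm_may_fail_two_layers[OF assms(1)] unfolding ts_def by blast
  have task_set: "task_set ts"
    using u n8 ab
    by (auto simp: task_set_def ts_def valid_task_def \<tau>\<^sub>1_def \<tau>\<^sub>2_def \<tau>\<^sub>3_def sorted_append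
        sorted_replicate)
  have L: "0 < L" "u \<le> L" "real a * (1 - u) \<le> L * real n" "real b * (1 - u) \<le> L * real n"
  proof -
    have "real n = 18 * real M * (1 - u)"
      using M1 by (simp add: real_nab u_def field_simps)
    moreover have "L * (18 * real M) = 6 * real M + 6"
      using M1 by (simp add: L_def)
    ultimately have Ln: "L * real n = (6 * real M + 6) * (1 - u)"
      by (metis mult.assoc)
    show "0 < L" "u \<le> L" using M1 by (simp_all add: L_def u_def field_simps)
    show "real a * (1 - u) \<le> L * real n" "real b * (1 - u) \<le> L * real n"
      unfolding Ln using u real_nab by (intro mult_right_mono; simp)+
  qed
  \<comment> \<open>At time \<open>n\<close> every task demands exactly one job. In units of
    \<open>M * (1 - u)\<close>, the capacity \<open>6 * M + 6\<close> exceeds the demand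
    \<open>6 * M - 5\<close> of the copies of \<open>\<tau>\<^sub>2\<close> by 11; of these, 8 cover
    \<open>\<tau>\<^sub>3\<close> and 3 the copies of \<open>\<tau>\<^sub>1\<close>.\<close>
  have at_deadline: "real M * u + real M * (real a * (1 - u)) + real b * (1 - u) \<le> real M * (L * real n)"
  proof -
    \<comment> \<open>With \<open>w = M (1 - u)\<close> the claim reduces to \<open>M u \<le> 3 w\<close>.\<close>
    define w where "w = (6 * real M - 2) / 9"
    have Mw: "real M * (1 - u) = w" using M1 by (simp add: w_def u_def field_simps)
    have "real b * (1 - u) \<le> (8 * real M) * (1 - u)"
      using u M1 real_nab by (intro mult_right_mono) auto
    then have "real b * (1 - u) \<le> 8 * w" by (simp add: Mw[symmetric])
    moreover have "real M * (real a * (1 - u)) = (6 * real M - 5) * w"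
      by (simp add: Mw[symmetric] real_nab)
    moreover have "real M * (L * real n) = (6 * real M + 6) * w"
      using M1 by (simp add: w_def L_def real_nab field_simps)
    moreover have "real M * u \<le> 3 * w"
      using M1 by (simp add: w_def u_def field_simps)
    ultimately show ?thesis by (simp add: algebra_simps)
  qed
  \<comment> \<open>Before \<open>n\<close> there is no demand. After \<open>n\<close> only the
    periodic tasks add any; a linear bound on the floor, tight at \<open>n\<close>, grows at total
    rate \<open>M * u\<close>, at most \<open>M * L\<close>, so \<open>at_deadline\<close> extends
    to all later times.\<close>
  have demand: "(\<Sum>\<tau>\<leftarrow>ts. dbf \<tau> t) / (real M * t) \<le> L" if t: "0 < t" for t
  proof -
    have sum: "(\<Sum>\<tau>\<leftarrow>ts. dbf \<tau> t) = real M * dbf \<tau>\<^sub>1 t + real M * dbf \<tau>\<^sub>2 t + dbf \<tau>\<^sub>3 t"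
      by (simp add: ts_def sum_list_replicate)
    have "(\<Sum>\<tau>\<leftarrow>ts. dbf \<tau> t) \<le> real M * (L * t)"
    proof (cases "t < real n")
      case True
      then have "\<lfloor>t - real n\<rfloor> + 1 \<le> 0" by linarith
      then have "max 0 (of_int \<lfloor>t - real n\<rfloor> + 1) = (0 :: real)" by linarith
      then show ?thesis
        unfolding sum using True t L by (simp add: dbf_def \<tau>\<^sub>1_def \<tau>\<^sub>2_def \<tau>\<^sub>3_def)
    next
      case False
      have "max 0 (of_int \<lfloor>t - real n\<rfloor> + 1) \<le> t - real n + 1" using False by linarith
      then have "dbf \<tau>\<^sub>1 t \<le> (t - real n + 1) * u"
        using u by (simp add: dbf_def \<tau>\<^sub>1_def mult_right_mono)
      then have "real M * dbf \<tau>\<^sub>1 t \<le> real M * ((t - real n + 1) * u)"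
        by (intro mult_left_mono) auto
      also have "\<dots> = real M * ((t - real n) * u) + real M * u" by (simp add: algebra_simps)
      finally have "real M * dbf \<tau>\<^sub>1 t \<le> real M * ((t - real n) * u) + real M * u" .
      moreover have "real M * ((t - real n) * u) \<le> real M * ((t - real n) * L)"
        using L False by (intro mult_left_mono) auto
      moreover have "real M * ((t - real n) * L) + real M * (L * real n) = real M * (L * t)"
        by (simp add: algebra_simps)
      moreover have "dbf \<tau>\<^sub>2 t = real a * (1 - u)" "dbf \<tau>\<^sub>3 t = real b * (1 - u)"
        using False by (simp_all add: dbf_def \<tau>\<^sub>2_def \<tau>\<^sub>3_def)
      ultimately show ?thesis
        unfolding sum using at_deadline by simp
    qed
    then show ?thesis using M1 t by (simp add: field_simps)
  qed
  have "Lam M ts \<le> ereal L"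
  proof -
    have "(SUP t\<in>{0<..}. ereal ((\<Sum>\<tau>\<leftarrow>ts. dbf \<tau> t) / (real M * t))) \<le> ereal L"
      using demand by (intro SUP_least) simp
    moreover have "(\<Sum>\<tau>\<leftarrow>ts. util \<tau>) / real M \<le> L"
      using L M1 by (simp add: ts_def sum_list_replicate period_1 period_inf)
    moreover have "density \<tau> \<le> L" if "\<tau> \<in> set ts" for \<tau>
    proof -
      have "u / real n \<le> u / 1" using u n8 by (intro divide_left_mono) auto
      then have "u / real n \<le> L" using L(2) by simp
      moreover have "real a * (1 - u) / real n \<le> L" "real b * (1 - u) / real n \<le> L"
        using L(3,4) n8 by (simp_all only: pos_divide_le_eq[of "real n"])
      moreover have "\<tau> = \<tau>\<^sub>1 \<or> \<tau> = \<tau>\<^sub>2 \<or> \<tau> = \<tau>\<^sub>3" using that by (auto simp: ts_def)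
      ultimately show ?thesis
        using L(1,2) by (auto simp: density_def period_1 period_inf wcets deadlines)
    qed
    then have "Max (density ` set ts) \<le> L" by (simp add: ts_def)
    ultimately show ?thesis by (simp add: Lam_def)
  qed
  then have Lam: "Lam M ts \<le> ereal (1 / \<rho>)"
    using \<rho>(2) by (meson ereal_less_eq(3) order_trans)
  \<comment> \<open>A factor below \<open>\<rho>\<close> has a larger reciprocal, so
    \<open>ts\<close> satisfies its premise too and refutes it.\<close>
  have "ereal \<rho> \<le> speedup_factor test M" if "test \<in> {linear_test, quadratic_test, exact_test}" for test
    unfolding speedup_factor_def
  proof (intro Inf_greatest, clarify)
    fix \<rho>' assume \<rho>': "0 < \<rho>'" "\<forall>ts. task_set ts \<and> Lam M ts \<le> ereal (1 / \<rho>') \<longrightarrow> \<not> dm_may_fail test M ts"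
    show "ereal \<rho> \<le> ereal \<rho>'"
    proof (rule ccontr)
      assume "\<not> ?thesis"
      then have "1 / \<rho> \<le> 1 / \<rho>'" using \<rho>'(1) by (simp add: frac_le)
      then have "Lam M ts \<le> ereal (1 / \<rho>')" using Lam by (meson ereal_less_eq(3) order_trans)
      then show False using \<rho>'(2) task_set may_fail[OF that] by blast
    qed
  qed
  then show ?thesis
    using task_set may_fail Lam unfolding \<rho>_def by blast
qed

end
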